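(* Let $A$ be an $n\times n$ real matrix whose eigenvalues are distinct, and let $p\geq 1$ be an integer. Then the following are equivalent: (i) there exists a vector $B_v\in\mathbb{R}^n$ with at most $k$ nonzero entries such that the system $\frac{dx(t)}{dt}=Ax(t)+B_v u(t)$ is controllable; (ii) there exists a real $n\times p$ matrix $B_f$ with at most $k$ nonzero entries such that the system $\frac{dx(t)}{dt}=Ax(t)+B_f u(t)$ is controllable.
   Context: Controllability refers to the usual notion for continuous-time linear time-invariant systems $\frac{dx}{dt}=Ax+Bu$ (controllability of the pair $(A,B)$). A vector or matrix is called $k$-sparse if it has at most $k$ nonzero entries; the paper phrases (i) as "the system $\Sigma_v$ is $k$-sparse controllable" and (ii) as "the system $\Sigma_f$ is $k$-sparse controllable". *)

theory Defs
  imports "HOL-Analysis.Analysis"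
begin

text \<open>Kalman controllability of the pair (A,B) for dx/dt = A x + B u:
  the columns of the controllability matrix [B, AB, ..., A^(n-1) B] span R^n.\<close>
definition controllable :: "real^'n^'n \<Rightarrow> real^'m^'n \<Rightarrow> bool" where
  "controllable A B \<longleftrightarrow>
     span {((\<lambda>x. A *v x) ^^ i) (column j B) | i j. i < CARD('n)} = UNIV"

text \<open>A vector viewed as an n x 1 input matrix.\<close>
definition col_matrix :: "real^'n \<Rightarrow> real^1^'n" where
  "col_matrix b = (\<chi> i j. b $ i)"

text \<open>Complexification of a real matrix.\<close>
definition cmat :: "real^'n^'n \<Rightarrow> complex^'n^'n" where
  "cmat A = (\<chi> i j. complex_of_real (A $ i $ j))"

text \<open>The (complex) eigenvalues of a real square matrix.\<close>
definition eigenvalues :: "real^'n^'n \<Rightarrow> complex set" where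
  "eigenvalues A = {c. \<exists>v. v \<noteq> 0 \<and> cmat A *v v = c *s v}"

text \<open>n x n matrix with distinct eigenvalues: n pairwise distinct eigenvalues.\<close>
definition distinct_eigenvalues :: "real^'n^'n \<Rightarrow> bool" where
  "distinct_eigenvalues A \<longleftrightarrow> card (eigenvalues A) = CARD('n)"

definition vec_sparse :: "nat \<Rightarrow> real^'n \<Rightarrow> bool" where
  "vec_sparse k b \<longleftrightarrow> card {i. b $ i \<noteq> 0} \<le> k"

definition mat_sparse :: "nat \<Rightarrow> real^'m^'n \<Rightarrow> bool" where
  "mat_sparse k B \<longleftrightarrow> card {(i, j). B $ i $ j \<noteq> 0} \<le> k"

end

theory Submission
  imports Defs
begin

(* For each eigenvalue l of A let P_l = prod_{m /= l} (A - m I). Since the n eigenvalues are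
   distinct, P_l maps C^n onto the eigenline of l and commutes with A, so (A, B) is controllable iff
   no P_l annihilates all columns of B. Hence if B_f is controllable, each of the finitely many
   real-linear maps c |-> P_l (B_f c) is nonzero, and a generic c avoids all of their kernels: the
   single input b = B_f c is controllable, and its support lies in the row support of B_f.
   Conversely, a sparse controllable vector padded with zero columns is a sparse controllable matrix. *)

fun apply_lin_factors :: "'a::field^'n^'n \<Rightarrow> 'a list \<Rightarrow> 'a^'n \<Rightarrow> 'a^'n" where
  "apply_lin_factors M [] x = x"
| "apply_lin_factors M (l # ls) x = M *v apply_lin_factors M ls x - l *s apply_lin_factors M ls x"

lemma apply_lin_factors_add:
  "apply_lin_factors M ls (x + y) = apply_lin_factors M ls x + apply_lin_factors M ls y"
  by (induction ls) (auto simp: algebra_simps matrix_vector_right_distrib vector_ssub_ldistrib)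

lemma apply_lin_factors_scale:
  "apply_lin_factors M ls (c *s x) = c *s apply_lin_factors M ls x"
  by (induction ls) (auto simp: vec.scale vector_ssub_ldistrib vector_smult_assoc mult.commute)

lemma linear_apply_lin_factors: "Vector_Spaces.linear (*s) (*s) (apply_lin_factors M ls)"
  unfolding Vector_Spaces.linear_iff using vec.vector_space_axioms
  by (simp add: apply_lin_factors_add apply_lin_factors_scale)

lemma apply_lin_factors_eigenvector:
  "M *v w = \<mu> *s w \<Longrightarrow> apply_lin_factors M ls w = (\<Prod>l\<leftarrow>ls. \<mu> - l) *s w"
  by (induction ls) (auto simp: vec.scale vector_smult_assoc algebra_simps)

lemma apply_lin_factors_commute_power:
  "apply_lin_factors M ls (((*v) M ^^ i) x) = ((*v) M ^^ i) (apply_lin_factors M ls x)"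
proof -
  have "apply_lin_factors M ls (M *v y) = M *v apply_lin_factors M ls y" for y
    by (induction ls) (auto simp: vec.scale vec.diff)
  then show ?thesis by (induction i) auto
qed

lemma apply_lin_factors_in_span:
  "apply_lin_factors M ls x \<in> vec.span {((*v) M ^^ j) x | j. j \<le> length ls}"
proof (induction ls)
  case Nil
  show ?case by (rule vec.span_base) (auto intro: exI[of _ 0])
next
  case (Cons l ls)
  let ?S = "\<lambda>m. {((*v) M ^^ j) x | j. j \<le> m}"
  have "(*v) M ` ?S (length ls) \<subseteq> ?S (length (l # ls))"
  proof (rule image_subsetI)
    fix y assume "y \<in> ?S (length ls)"
    then obtain j where "j \<le> length ls" "y = ((*v) M ^^ j) x" by blast
    then show "M *v y \<in> ?S (length (l # ls))"
      by (auto intro!: exI[of _ "Suc j"])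
  qed
  then have "vec.span ((*v) M ` ?S (length ls)) \<subseteq> vec.span (?S (length (l # ls)))"
    by (rule vec.span_mono)
  moreover have "M *v apply_lin_factors M ls x \<in> vec.span ((*v) M ` ?S (length ls))"
    using Cons.IH by (simp add: vec.span_image)
  ultimately have "M *v apply_lin_factors M ls x \<in> vec.span (?S (length (l # ls)))"
    by blast
  moreover have "vec.span (?S (length ls)) \<subseteq> vec.span (?S (length (l # ls)))"
    by (rule vec.span_mono) auto
  ultimately show ?case
    using Cons by (auto intro!: vec.span_diff vec.span_scale)
qed

(* spectral_factor M L l is prod_{m in L - {l}} (M - m I), the numerator of the Lagrange basis
   polynomial of l evaluated at M. The factors commute, so the list chosen by SOME is irrelevant. *)
definition spectral_factor :: "'a::field^'n^'n \<Rightarrow> 'a set \<Rightarrow> 'a \<Rightarrow> 'a^'n \<Rightarrow> 'a^'n" where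
  "spectral_factor M L l = apply_lin_factors M (SOME ls. set ls = L - {l} \<and> distinct ls)"

lemma spectral_factor_list:
  assumes "finite L"
  obtains ls where "set ls = L - {l}" "distinct ls" "spectral_factor M L l = apply_lin_factors M ls"
proof -
  have "\<exists>ls. set ls = L - {l} \<and> distinct ls"
    using assms finite_distinct_list[of "L - {l}"] by blast
  then have "set (SOME ls. set ls = L - {l} \<and> distinct ls) = L - {l} \<and>
      distinct (SOME ls. set ls = L - {l} \<and> distinct ls)"
    by (rule someI_ex)
  then show ?thesis by (intro that) (auto simp: spectral_factor_def)
qed

lemma linear_spectral_factor:
  "finite L \<Longrightarrow> Vector_Spaces.linear (*s) (*s) (spectral_factor M L l)"
  by (metis spectral_factor_list linear_apply_lin_factors)

lemma spectral_factor_commute_power: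
  "finite L \<Longrightarrow> spectral_factor M L l (((*v) M ^^ i) x) = ((*v) M ^^ i) (spectral_factor M L l x)"
  by (metis spectral_factor_list apply_lin_factors_commute_power)

lemma spectral_factor_eigenvector:
  assumes "finite L" "M *v w = \<mu> *s w"
  shows "spectral_factor M L l w = (\<Prod>m\<in>L - {l}. \<mu> - m) *s w"
proof -
  obtain ls where "set ls = L - {l}" "distinct ls" "spectral_factor M L l = apply_lin_factors M ls"
    using spectral_factor_list[OF assms(1)] .
  then have "(\<Prod>m\<in>L - {l}. \<mu> - m) = (\<Prod>m\<leftarrow>ls. \<mu> - m)"
    using prod.distinct_set_conv_list[of ls "\<lambda>m. \<mu> - m"] by simp
  with \<open>spectral_factor M L l = apply_lin_factors M ls\<close> show ?thesis
    using apply_lin_factors_eigenvector[OF assms(2)] by simp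
qed

lemma spectral_factor_in_span:
  assumes "finite L" "l \<in> L"
  shows "spectral_factor M L l x \<in> vec.span {((*v) M ^^ j) x | j. j < card L}"
proof -
  obtain ls where ls: "set ls = L - {l}" "distinct ls" "spectral_factor M L l = apply_lin_factors M ls"
    using spectral_factor_list[OF assms(1)] .
  have "card L > 0"
    using assms card_gt_0_iff by blast
  then have "length ls < card L"
    using ls(1,2) assms distinct_card[of ls] by simp
  then have "vec.span {((*v) M ^^ j) x | j. j \<le> length ls}
      \<subseteq> vec.span {((*v) M ^^ j) x | j. j < card L}"
    by (intro vec.span_mono) auto
  then show ?thesis
    using ls(3) apply_lin_factors_in_span[of M ls x] by auto
qed

definition krylov :: "'a::field^'n^'n \<Rightarrow> ('a^'n) set \<Rightarrow> ('a^'n) set" where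
  "krylov M X = {((*v) M ^^ i) x | i x. i < CARD('n) \<and> x \<in> X}"

locale distinct_eigenvectors =
  fixes M :: "'a::field^'n^'n" and L :: "'a set" and v :: "'a \<Rightarrow> 'a^'n"
  assumes card_L: "card L = CARD('n)"
    and eigenvector_nonzero: "l \<in> L \<Longrightarrow> v l \<noteq> 0"
    and eigenvector: "l \<in> L \<Longrightarrow> M *v v l = l *s v l"
begin

lemma finite_L: "finite L"
  using card_L by (intro card_ge_0_finite) simp

lemma spectral_factor_eigenvector_self:
  "l \<in> L \<Longrightarrow> spectral_factor M L l (v l) = (\<Prod>m\<in>L - {l}. l - m) *s v l"
  by (rule spectral_factor_eigenvector[OF finite_L eigenvector])

lemma spectral_factor_eigenvector_other:
  "l \<in> L \<Longrightarrow> m \<in> L \<Longrightarrow> m \<noteq> l \<Longrightarrow> spectral_factor M L l (v m) = 0"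
  using spectral_factor_eigenvector[OF finite_L eigenvector, of m l] finite_L by auto

lemma eigenvalue_gaps_nonzero: "(\<Prod>m\<in>L - {l}. l - m) \<noteq> 0"
  using finite_L by simp

lemma spectral_factor_sum_eigenvectors:
  assumes "l \<in> L"
  shows "spectral_factor M L l (\<Sum>m\<in>L. c m *s v m) = (c l * (\<Prod>m\<in>L - {l}. l - m)) *s v l"
proof -
  have "spectral_factor M L l (\<Sum>m\<in>L. c m *s v m) = (\<Sum>m\<in>L. c m *s spectral_factor M L l (v m))"
    using linear_spectral_factor[OF finite_L, of M l] by (simp add: vec.linear_sum vec.linear_scale)
  also have "\<dots> = c l *s spectral_factor M L l (v l)"
    using finite_L assms by (simp add: sum.remove spectral_factor_eigenvector_other)
  finally show ?thesis
    using assms by (simp add: spectral_factor_eigenvector_self vector_smult_assoc)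
qed

lemma inj_on_eigenvectors: "inj_on v L"
proof
  fix l m assume "l \<in> L" "m \<in> L" "v l = v m"
  then have "l *s v l = m *s v l"
    using eigenvector by metis
  then have "(l - m) *s v l = 0"
    by (simp add: vec.scale_left_diff_distrib)
  then show "l = m" using eigenvector_nonzero \<open>l \<in> L\<close> by simp
qed

lemma independent_eigenvectors: "vec.independent (v ` L)"
  unfolding vec.independent_explicit
proof (intro conjI allI impI ballI)
  show "finite (v ` L)" using finite_L by simp
  fix c u assume sum0: "(\<Sum>x\<in>v ` L. c x *s x) = 0" and "u \<in> v ` L"
  then obtain l where l: "l \<in> L" "u = v l" by auto
  have "(\<Sum>m\<in>L. c (v m) *s v m) = 0"
    using sum0 by (simp add: sum.reindex[OF inj_on_eigenvectors])
  then have "(c (v l) * (\<Prod>m\<in>L - {l}. l - m)) *s v l = 0"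
    using spectral_factor_sum_eigenvectors[OF l(1), of "c \<circ> v"]
      vec.linear_0[OF linear_spectral_factor[OF finite_L, of M l]]
    by simp
  then show "c u = 0" using eigenvector_nonzero[OF l(1)] eigenvalue_gaps_nonzero l by simp
qed

lemma span_eigenvectors: "vec.span (v ` L) = UNIV"
proof -
  have "vec.dim (v ` L) = CARD('n)"
    using vec.dim_eq_card_independent[OF independent_eigenvectors]
      card_image[OF inj_on_eigenvectors] card_L by simp
  then show ?thesis
    using vec.dim_eq_full[of "v ` L"] by (simp add: vec.dimension_def card_cart_basis)
qed

lemma spectral_factor_range: "l \<in> L \<Longrightarrow> \<exists>z. spectral_factor M L l w = z *s v l"
proof -
  assume l: "l \<in> L"
  obtain c where "w = (\<Sum>x\<in>v ` L. c x *s x)"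
    using span_eigenvectors vec.span_finite[of "v ` L"] finite_L by auto
  then have "w = (\<Sum>m\<in>L. c (v m) *s v m)" by (simp add: sum.reindex[OF inj_on_eigenvectors])
  then show ?thesis using spectral_factor_sum_eigenvectors[OF l, of "c \<circ> v"] by auto
qed

lemma span_krylov_imp_spectral_factor_nonzero:
  assumes span: "vec.span (krylov M X) = UNIV" and l: "l \<in> L"
  shows "\<exists>x\<in>X. spectral_factor M L l x \<noteq> 0"
proof (rule ccontr)
  assume "\<not> ?thesis"
  moreover have "((*v) M ^^ i) 0 = 0" for i by (induction i) auto
  ultimately have "spectral_factor M L l y = 0" if "y \<in> krylov M X" for y
    using that finite_L by (auto simp: krylov_def spectral_factor_commute_power)
  then have "spectral_factor M L l (v l) = 0"
    using vec.linear_eq_0_on_span[OF linear_spectral_factor[OF finite_L]] span by blast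
  then show False
    using spectral_factor_eigenvector_self[OF l] eigenvector_nonzero[OF l] eigenvalue_gaps_nonzero
    by simp
qed

lemma spectral_factor_nonzero_imp_span_krylov:
  assumes nonzero: "\<forall>l\<in>L. spectral_factor M L l b \<noteq> 0"
  shows "vec.span (krylov M {b}) = UNIV"
proof -
  have "v l \<in> vec.span (krylov M {b})" if l: "l \<in> L" for l
  proof -
    obtain z where z: "spectral_factor M L l b = z *s v l"
      using spectral_factor_range[OF l] by blast
    with nonzero l have "z \<noteq> 0" by auto
    have "{((*v) M ^^ j) b | j. j < card L} \<subseteq> krylov M {b}"
      using card_L by (auto simp: krylov_def)
    then have "vec.span {((*v) M ^^ j) b | j. j < card L} \<subseteq> vec.span (krylov M {b})"
      by (rule vec.span_mono)
    then have "spectral_factor M L l b \<in> vec.span (krylov M {b})"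
      using spectral_factor_in_span[OF finite_L l] by auto
    then have "inverse z *s spectral_factor M L l b \<in> vec.span (krylov M {b})"
      by (rule vec.span_scale)
    then show ?thesis using z \<open>z \<noteq> 0\<close> by (simp add: vector_smult_assoc)
  qed
  then have "vec.span (v ` L) \<subseteq> vec.span (krylov M {b})"
    by (intro vec.span_minimal) auto
  then show ?thesis using span_eigenvectors by auto
qed

end

definition complexify :: "real^'n \<Rightarrow> complex^'n" where
  "complexify x = (\<chi> i. complex_of_real (x $ i))"

definition Re_vec :: "complex^'n \<Rightarrow> real^'n" where
  "Re_vec w = (\<chi> i. Re (w $ i))"

definition Im_vec :: "complex^'n \<Rightarrow> real^'n" where
  "Im_vec w = (\<chi> i. Im (w $ i))"

lemma complexify_Re_Im: "complexify (Re_vec w) + \<i> *s complexify (Im_vec w) = w"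
  by (simp add: complexify_def Re_vec_def Im_vec_def vec_eq_iff complex_eq_iff)

lemma linear_complexify: "linear complexify"
  by (rule linearI) (auto simp: complexify_def vec_eq_iff complex_eq_iff)

lemma of_real_vector_scale: "complex_of_real r *s w = r *\<^sub>R (w :: complex^'n)"
  by (auto simp: vec_eq_iff complex_eq_iff)

lemma linear_if_complex_linear:
  "Vector_Spaces.linear (*s) (*s) (f :: complex^'n \<Rightarrow> complex^'m) \<Longrightarrow> linear f"
  by (rule linearI) (simp_all add: vec.linear_add vec.linear_scale of_real_vector_scale[symmetric])

lemma cmat_complexify_power:
  "((*v) (cmat A) ^^ i) (complexify x) = complexify (((*v) A ^^ i) x)"
proof -
  have "cmat A *v complexify y = complexify (A *v y)" for y
    by (simp add: complexify_def cmat_def vec_eq_iff matrix_vector_mult_def)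
  then show ?thesis by (induction i) auto
qed

lemma krylov_complexify:
  fixes A :: "real^'n^'n"
  shows "complexify ` krylov A X = krylov (cmat A) (complexify ` X)"
proof -
  have "complexify ` krylov A X = {complexify (((*v) A ^^ i) x) | i x. i < CARD('n) \<and> x \<in> X}"
    unfolding krylov_def by blast
  also have "\<dots> = {((*v) (cmat A) ^^ i) (complexify x) | i x. i < CARD('n) \<and> x \<in> X}"
    by (simp only: cmat_complexify_power)
  also have "\<dots> = krylov (cmat A) (complexify ` X)"
    unfolding krylov_def by blast
  finally show ?thesis .
qed

lemma span_subset_complex_span: "span T \<subseteq> vec.span (T :: (complex^'n) set)"
proof (rule span_minimal)
  show "subspace (vec.span T)"
    unfolding subspace_def
    by (auto simp: vec.span_zero vec.span_add of_real_vector_scale[symmetric] intro: vec.span_scale)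
qed (rule vec.span_superset)

lemma Re_Im_vec_in_span:
  fixes S :: "(real^'n) set"
  assumes "w \<in> vec.span (complexify ` S)"
  shows "Re_vec w \<in> span S \<and> Im_vec w \<in> span S"
  using assms
proof (induction rule: vec.span_induct_alt)
  case base
  have "Re_vec (0 :: complex^'n) = 0" "Im_vec (0 :: complex^'n) = 0"
    by (simp_all add: Re_vec_def Im_vec_def vec_eq_iff)
  then show ?case by (simp add: span_zero)
next
  case (step c x y)
  then obtain s where "s \<in> S" "x = complexify s" by auto
  moreover have "Re_vec (c *s complexify s + y) = Re c *\<^sub>R s + Re_vec y"
    "Im_vec (c *s complexify s + y) = Im c *\<^sub>R s + Im_vec y"
    by (simp_all add: Re_vec_def Im_vec_def complexify_def vec_eq_iff)
  ultimately show ?case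
    using step.IH by (auto intro: span_add span_scale span_base)
qed

lemma span_complexify_eq_UNIV: "vec.span (complexify ` S) = UNIV \<longleftrightarrow> span S = UNIV"
proof
  assume "vec.span (complexify ` S) = UNIV"
  then have "Re_vec (complexify x) \<in> span S" for x
    using Re_Im_vec_in_span by blast
  moreover have "Re_vec (complexify x) = x" for x
    by (simp add: complexify_def Re_vec_def vec_eq_iff)
  ultimately show "span S = UNIV" by (metis UNIV_eq_I)
next
  assume "span S = UNIV"
  then have "complexify x \<in> span (complexify ` S)" for x
    by (simp add: span_linear_image[OF linear_complexify])
  then have "complexify x \<in> vec.span (complexify ` S)" for x
    using span_subset_complex_span by blast
  then have "w \<in> vec.span (complexify ` S)" for w
    using complexify_Re_Im[of w] by (metis vec.span_add vec.span_scale)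
  then show "vec.span (complexify ` S) = UNIV" by blast
qed

lemma column_col_matrix [simp]: "column j (col_matrix b) = b"
  by (simp add: column_def col_matrix_def vec_eq_iff)

lemma controllable_iff_span_krylov:
  fixes A :: "real^'n^'n"
  shows "controllable A B \<longleftrightarrow> span (krylov A (range (\<lambda>j. column j B))) = UNIV"
proof -
  have "{((\<lambda>x. A *v x) ^^ i) (column j B) | i j. i < CARD('n)} = krylov A (range (\<lambda>j. column j B))"
    unfolding krylov_def by blast
  then show ?thesis by (simp add: controllable_def)
qed

lemma controllable_iff_complex_span_krylov:
  "controllable A B \<longleftrightarrow> vec.span (krylov (cmat A) (range (\<lambda>j. complexify (column j B)))) = UNIV"
  by (simp add: controllable_iff_span_krylov span_complexify_eq_UNIV[symmetric]
      krylov_complexify image_image)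

lemma controllable_col_matrix_column:
  "controllable A (col_matrix (column j B)) \<Longrightarrow> controllable A B"
proof -
  have "krylov A {column j B} \<subseteq> krylov A (range (\<lambda>j. column j B))"
    unfolding krylov_def by blast
  then show "controllable A (col_matrix (column j B)) \<Longrightarrow> controllable A B"
    by (simp add: controllable_iff_span_krylov) (metis span_mono top.extremum_uniqueI)
qed

lemma distinct_eigenvalues_imp_eigenvectors:
  assumes "distinct_eigenvalues A"
  obtains v where "distinct_eigenvectors (cmat A) (eigenvalues A) v"
proof -
  have "\<forall>l\<in>eigenvalues A. \<exists>w. w \<noteq> 0 \<and> cmat A *v w = l *s w"
    by (simp add: eigenvalues_def)
  then obtain v where "\<And>l. l \<in> eigenvalues A \<Longrightarrow> v l \<noteq> 0 \<and> cmat A *v v l = l *s v l"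
    by metis
  with assms have "distinct_eigenvectors (cmat A) (eigenvalues A) v"
    by (simp add: distinct_eigenvectors_def distinct_eigenvalues_def)
  then show ?thesis by (rule that)
qed

lemma finite_vanishing_on_line:
  fixes y z :: "'a::real_vector"
  assumes "y \<noteq> 0 \<or> z \<noteq> 0"
  shows "finite {t::real. y + t *\<^sub>R z = 0}"
proof -
  have "a = b" if "y + a *\<^sub>R z = 0" "y + b *\<^sub>R z = 0" for a b
  proof -
    have "(a - b) *\<^sub>R z = (y + a *\<^sub>R z) - (y + b *\<^sub>R z)"
      by (simp add: scaleR_diff_left)
    also have "\<dots> = 0" using that by simp
    finally have "(a - b) *\<^sub>R z = 0" .
    moreover have "z \<noteq> 0" using that assms by auto
    ultimately show "a = b" by simp
  qed
  then have "{t. y + t *\<^sub>R z = 0} \<subseteq> {t0}" if "y + t0 *\<^sub>R z = 0" for t0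
    using that by blast
  then show ?thesis
    by (cases "\<exists>t0. y + t0 *\<^sub>R z = 0") (auto intro: finite_subset)
qed

lemma linear_maps_simultaneously_nonzero:
  fixes \<phi> :: "'i \<Rightarrow> 'a::real_vector \<Rightarrow> 'b::real_vector"
  assumes "finite I" "\<And>i. i \<in> I \<Longrightarrow> linear (\<phi> i)" "\<And>i. i \<in> I \<Longrightarrow> \<exists>d. \<phi> i d \<noteq> 0"
  shows "\<exists>c. \<forall>i\<in>I. \<phi> i c \<noteq> 0"
  using assms
proof (induction I rule: finite_induct)
  case empty
  then show ?case by simp
next
  case (insert a F)
  have "\<exists>c. \<forall>i\<in>F. \<phi> i c \<noteq> 0"
    by (rule insert.IH) (simp_all add: insert.prems)
  then obtain c where c: "\<forall>i\<in>F. \<phi> i c \<noteq> 0" ..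
  obtain d where d: "\<phi> a d \<noteq> 0"
    using insert.prems(2) by blast
  (* On the line c + t d, each \<phi> i vanishes for at most one t. *)
  define T where "T = (\<Union>i\<in>insert a F. {t::real. \<phi> i c + t *\<^sub>R \<phi> i d = 0})"
  have "finite {t::real. \<phi> i c + t *\<^sub>R \<phi> i d = 0}" if "i \<in> insert a F" for i
    using that c d by (intro finite_vanishing_on_line) auto
  then have "finite T"
    unfolding T_def using insert.hyps(1) by blast
  then obtain t where t: "t \<notin> T"
    using ex_new_if_finite[OF infinite_UNIV_char_0] by blast
  have "\<phi> i (c + t *\<^sub>R d) \<noteq> 0" if i: "i \<in> insert a F" for i
  proof -
    have "\<phi> i (c + t *\<^sub>R d) = \<phi> i c + t *\<^sub>R \<phi> i d"
      using insert.prems(1)[OF i] by (simp add: linear_add linear_scale)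
    moreover have "\<phi> i c + t *\<^sub>R \<phi> i d \<noteq> 0"
      using t i unfolding T_def by blast
    ultimately show ?thesis by simp
  qed
  then show ?case by blast
qed

lemma controllable_col_matrix_iff:
  "controllable A (col_matrix b) \<longleftrightarrow> vec.span (krylov (cmat A) {complexify b}) = UNIV"
  by (simp add: controllable_iff_complex_span_krylov)

lemma controllable_imp_controllable_combination:
  assumes "distinct_eigenvalues A" and "controllable A B"
  shows "\<exists>c. controllable A (col_matrix (B *v c))"
proof -
  obtain v where "distinct_eigenvectors (cmat A) (eigenvalues A) v"
    using distinct_eigenvalues_imp_eigenvectors[OF assms(1)] .
  then interpret distinct_eigenvectors "cmat A" "eigenvalues A" v .
  define \<phi> where "\<phi> l = spectral_factor (cmat A) (eigenvalues A) l \<circ> complexify \<circ> (*v) B" for l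
  have "\<exists>c. \<forall>l\<in>eigenvalues A. \<phi> l c \<noteq> 0"
  proof (rule linear_maps_simultaneously_nonzero[OF finite_L])
    fix l assume l: "l \<in> eigenvalues A"
    show "linear (\<phi> l)"
      unfolding \<phi>_def
      using linear_if_complex_linear[OF linear_spectral_factor[OF finite_L]]
        linear_complexify matrix_vector_mul_linear[of B]
      by (intro linear_compose) auto
    have "vec.span (krylov (cmat A) (range (\<lambda>j. complexify (column j B)))) = UNIV"
      using assms(2) controllable_iff_complex_span_krylov by blast
    then obtain j where "spectral_factor (cmat A) (eigenvalues A) l (complexify (column j B)) \<noteq> 0"
      using span_krylov_imp_spectral_factor_nonzero[OF _ l] by blast
    then show "\<exists>d. \<phi> l d \<noteq> 0"
      by (intro exI[of _ "axis j 1"]) (simp add: \<phi>_def matrix_vector_mult_basis)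
  qed
  then obtain c where "\<forall>l\<in>eigenvalues A. \<phi> l c \<noteq> 0" ..
  then have "vec.span (krylov (cmat A) {complexify (B *v c)}) = UNIV"
    unfolding \<phi>_def by (intro spectral_factor_nonzero_imp_span_krylov) simp
  then show ?thesis
    by (auto simp: controllable_col_matrix_iff)
qed

lemma vec_sparse_matrix_vector_mult:
  assumes "mat_sparse k B"
  shows "vec_sparse k (B *v c)"
proof -
  have "{i. (B *v c) $ i \<noteq> 0} \<subseteq> fst ` {(i, j). B $ i $ j \<noteq> 0}"
  proof
    fix i assume "i \<in> {i. (B *v c) $ i \<noteq> 0}"
    then have "(\<Sum>j\<in>UNIV. B $ i $ j * c $ j) \<noteq> 0"
      by (simp add: matrix_vector_mult_def)
    then obtain j where "B $ i $ j \<noteq> 0"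
      by (metis (mono_tags, lifting) mult_eq_0_iff sum.neutral)
    then show "i \<in> fst ` {(i, j). B $ i $ j \<noteq> 0}" by force
  qed
  then have "card {i. (B *v c) $ i \<noteq> 0} \<le> card (fst ` {(i, j). B $ i $ j \<noteq> 0})"
    by (intro card_mono) simp_all
  also have "\<dots> \<le> card {(i, j). B $ i $ j \<noteq> 0}"
    by (rule card_image_le) simp
  finally show ?thesis
    using assms by (simp add: vec_sparse_def mat_sparse_def)
qed

lemma ex_mat_sparse_with_column:
  assumes "vec_sparse k b"
  shows "\<exists>B :: real^'m^'n. mat_sparse k B \<and> column j B = b"
proof -
  define B :: "real^'m^'n" where "B = (\<chi> i j'. if j' = j then b $ i else 0)"
  have "{(i, j'). B $ i $ j' \<noteq> 0} = (\<lambda>i. (i, j)) ` {i. b $ i \<noteq> 0}"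
    by (auto simp: B_def split: if_splits)
  then have "mat_sparse k B"
    using assms by (simp add: mat_sparse_def vec_sparse_def card_image inj_on_def)
  moreover have "column j B = b"
    by (simp add: B_def column_def vec_eq_iff)
  ultimately show ?thesis by blast
qed

theorem theorem3:
  fixes A :: "real^'n^'n" and k :: nat
  assumes "distinct_eigenvalues A"
  shows "(\<exists>Bv :: real^'n. vec_sparse k Bv \<and> controllable A (col_matrix Bv)) \<longleftrightarrow>
         (\<exists>Bf :: real^'p^'n. mat_sparse k Bf \<and> controllable A Bf)"
proof
  assume "\<exists>Bv :: real^'n. vec_sparse k Bv \<and> controllable A (col_matrix Bv)"
  then obtain b :: "real^'n" where "vec_sparse k b" and "controllable A (col_matrix b)"
    by blast
  moreover obtain B :: "real^'p^'n" where "mat_sparse k B" and "column undefined B = b"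
    using ex_mat_sparse_with_column[OF \<open>vec_sparse k b\<close>] by blast
  ultimately show "\<exists>Bf :: real^'p^'n. mat_sparse k Bf \<and> controllable A Bf"
    using controllable_col_matrix_column by blast
next
  assume "\<exists>Bf :: real^'p^'n. mat_sparse k Bf \<and> controllable A Bf"
  then obtain B :: "real^'p^'n" where "mat_sparse k B" and "controllable A B"
    by blast
  then obtain c where "controllable A (col_matrix (B *v c))"
    using controllable_imp_controllable_combination[OF assms] by blast
  then show "\<exists>Bv :: real^'n. vec_sparse k Bv \<and> controllable A (col_matrix Bv)"
    using vec_sparse_matrix_vector_mult[OF \<open>mat_sparse k B\<close>] by blast
qed

end
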